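(* Let $\mathcal{C}_2=\mathcal{C}(K_2)$ be the characteristic algebra over $\mathbb{F}=\mathbb{Z}/2\mathbb{Z}$ of the Legendrian representative $K_2$ of $m(10_{132})$ given by the plat front with braid word $4,5,3,5,3,2,4,1,3,2,4,2,5,1,3,2,4,4,3,5,4,2$; explicitly, $\mathcal{C}_2$ is the $\mathbb{F}$-algebra with the presentation given in the context. Then $\mathcal{C}_2$ has no finite-dimensional representations: for every $n\geq 1$ there is no unital $\mathbb{F}$-algebra homomorphism $\mathcal{C}_2\to\mathrm{Mat}_n(\mathbb{F})$.
   Context: The characteristic algebra of a Legendrian knot $K$ is the quotient $\mathcal{C}(K)=Ch(K)/\langle\operatorname{im}\partial\rangle$ of its Chekanov-Eliashberg differential graded algebra $(Ch(K),\partial)$ over $\mathbb{F}$ by the two-sided ideal generated by the image of $\partial$. For $K_2$, $Ch(K_2)$ is the free unital associative (noncommutative) $\mathbb{F}$-algebra on $x_1,\dots,x_{25}$, and $\mathcal{C}_2$ is its quotient by the two-sided ideal generated by all $\partial x_i$. With the abbreviations $s=x_2+x_3$ and $$c=s+(1+sx_4)x_{17}+x_{14}(x_{13}+x_8s)+x_{16}(1+x_5s),$$ the nonzero differentials are $\partial x_2=\partial x_3=x_1$; $\partial x_7=x_4+x_5(1+sx_4)$; $\partial x_8=x_6$; $\partial x_9=x_6(1+sx_4)$; $\partial x_{10}=x_9+x_8(1+sx_4)$; $\partial x_{13}=x_6s+x_{11}(1+x_5s)$; $\partial x_{14}=(1+sx_4)x_{12}$; $\partial x_{15}=x_{12}x_{11}$;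 $\partial x_{16}=x_{14}x_{11}+(1+sx_4)x_{15}$; $\partial x_{17}=x_{12}(x_{13}+x_8s)+x_{15}(1+x_5s)$; $\partial x_{19}=(1+sx_4)+cx_{18}$; $\partial x_{20}=x_{18}x_{12}$; $\partial x_{21}=x_{14}+x_{19}x_{12}+cx_{20}$; $\partial x_{22}=(1+x_5s)x_{18}$; $\partial x_{23}=1+x_{11}x_{22}+(x_{13}+x_8s)x_{18}$; $\partial x_{24}=1+x_{22}x_{12}+(1+x_5s)x_{20}$; $\partial x_{25}=1+c$; and $\partial x_i=0$ for $i\in\{1,4,5,6,11,12,18\}$. *)

theory Defs
  imports
    "HOL-Library.Poly_Mapping"
    "HOL-Library.Z2"
    "HOL-Algebra.QuotRing"
    "HOL-Algebra.Module"
    "Jordan_Normal_Form.Matrix"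
begin

section \<open>Free unital associative algebras\<close>

text \<open>
  Finitely supported functions on a monoid carry the convolution product, but the library
  writes the monoid additively.  So words get an (in general noncommutative) addition,
  namely concatenation, and \<open>'g word \<Rightarrow>\<^sub>0 'k\<close> is then the free
  unital associative algebra on \<open>'g\<close>.
\<close>

datatype 'a word = Word (letters: "'a list")

instantiation word :: (type) monoid_add
begin

definition zero_word :: "'a word" where
  "0 = Word []"

definition plus_word :: "'a word \<Rightarrow> 'a word \<Rightarrow> 'a word" where
  "u + v = Word (letters u @ letters v)"

instance
  by standard (simp_all add: zero_word_def plus_word_def)

end

type_synonym ('g, 'k) free_alg = "'g word \<Rightarrow>\<^sub>0 'k"

definition gen :: "'g \<Rightarrow> ('g, 'k::comm_ring_1) free_alg" where
  "gen g = Poly_Mapping.single (Word [g]) 1"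

definition scalar :: "'k \<Rightarrow> ('g, 'k::comm_ring_1) free_alg" where
  "scalar a = Poly_Mapping.single 0 a"


section \<open>Algebras, quotients and homomorphisms\<close>

text \<open>
  A unital associative algebra over \<open>'k\<close> is represented by the record type
  \<open>('k, 'a) module\<close>, which extends rings (not assumed commutative) by a scalar
  multiplication.
\<close>

definition free_algebra :: "('k::comm_ring_1, ('g, 'k) free_alg) module" where
  "free_algebra = \<lparr>carrier = UNIV, monoid.mult = (*), one = 1, zero = 0, add = (+),
     smult = (\<lambda>a p. scalar a * p)\<rparr>"

text \<open>
  The scalar multiplication of the quotient sends the coset of \<open>p\<close> to the coset of
  \<open>a \<odot> p\<close>; see \<open>quotient_smult_coset\<close> below.
\<close>

definition quotient_algebra :: "('k, 'a) module \<Rightarrow> 'a set \<Rightarrow> ('k, 'a set) module" where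
  "quotient_algebra A I =
     ring.extend (A Quot I) (module.fields (\<lambda>a X. \<Union>p\<in>X. I +>\<^bsub>A\<^esub> (a \<odot>\<^bsub>A\<^esub> p)))"

definition algebra_hom :: "('k, 'a) module \<Rightarrow> ('k, 'b) module \<Rightarrow> ('a \<Rightarrow> 'b) set" where
  "algebra_hom A B =
     {h \<in> Ring.ring_hom A B. \<forall>a. \<forall>p\<in>carrier A. h (a \<odot>\<^bsub>A\<^esub> p) = a \<odot>\<^bsub>B\<^esub> h p}"

abbreviation matrix_algebra :: "nat \<Rightarrow> ('k::comm_ring_1, 'k mat) module" where
  "matrix_algebra n \<equiv> module_mat TYPE('k) n n"


section \<open>The characteristic algebra of the knot\<close>

datatype generator =
    X1 | X2 | X3 | X4 | X5 | X6 | X7 | X8 | X9 | X10 | X11 | X12 | X13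
  | X14 | X15 | X16 | X17 | X18 | X19 | X20 | X21 | X22 | X23 | X24 | X25

type_synonym Ch_K2 = "(generator, bit) free_alg"

definition K2_s :: Ch_K2 where
  "K2_s = gen X2 + gen X3"

definition K2_c :: Ch_K2 where
  "K2_c = K2_s + (1 + K2_s * gen X4) * gen X17 + gen X14 * (gen X13 + gen X8 * K2_s)
          + gen X16 * (1 + gen X5 * K2_s)"

fun K2_differential :: "generator \<Rightarrow> Ch_K2" where
  "K2_differential X1 = 0"
| "K2_differential X2 = gen X1"
| "K2_differential X3 = gen X1"
| "K2_differential X4 = 0"
| "K2_differential X5 = 0"
| "K2_differential X6 = 0"
| "K2_differential X7 = gen X4 + gen X5 * (1 + K2_s * gen X4)"
| "K2_differential X8 = gen X6"
| "K2_differential X9 = gen X6 * (1 + K2_s * gen X4)"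
| "K2_differential X10 = gen X9 + gen X8 * (1 + K2_s * gen X4)"
| "K2_differential X11 = 0"
| "K2_differential X12 = 0"
| "K2_differential X13 = gen X6 * K2_s + gen X11 * (1 + gen X5 * K2_s)"
| "K2_differential X14 = (1 + K2_s * gen X4) * gen X12"
| "K2_differential X15 = gen X12 * gen X11"
| "K2_differential X16 = gen X14 * gen X11 + (1 + K2_s * gen X4) * gen X15"
| "K2_differential X17 =
     gen X12 * (gen X13 + gen X8 * K2_s) + gen X15 * (1 + gen X5 * K2_s)"
| "K2_differential X18 = 0"
| "K2_differential X19 = (1 + K2_s * gen X4) + K2_c * gen X18"
| "K2_differential X20 = gen X18 * gen X12"
| "K2_differential X21 = gen X14 + gen X19 * gen X12 + K2_c * gen X20"
| "K2_differential X22 = (1 + gen X5 * K2_s) * gen X18"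
| "K2_differential X23 = 1 + gen X11 * gen X22 + (gen X13 + gen X8 * K2_s) * gen X18"
| "K2_differential X24 = 1 + gen X22 * gen X12 + (1 + gen X5 * K2_s) * gen X20"
| "K2_differential X25 = 1 + K2_c"

text \<open>
  Only the values of the differential on generators are recorded: by the Leibniz rule they
  generate the same two-sided ideal as the whole image of the differential.  The library's
  \<open>ideal\<close>, and hence \<open>Idl\<close>, is two-sided.
\<close>

definition K2_ideal :: "Ch_K2 set" where
  "K2_ideal = Idl\<^bsub>free_algebra :: (bit, Ch_K2) module\<^esub> (range K2_differential)"

definition C2 :: "(bit, Ch_K2 set) module" where
  "C2 = quotient_algebra free_algebra K2_ideal"


section \<open>Well-definedness\<close>

lemma free_algebra_simps [simp]:
  "carrier free_algebra = UNIV"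
  "monoid.mult free_algebra = (*)"
  "one free_algebra = 1"
  "zero free_algebra = 0"
  "add free_algebra = (+)"
  "smult free_algebra a p = scalar a * p"
  by (simp_all add: free_algebra_def)

lemma quotient_algebra_simps:
  "carrier (quotient_algebra A I) = carrier (A Quot I)"
  "monoid.mult (quotient_algebra A I) = monoid.mult (A Quot I)"
  "one (quotient_algebra A I) = one (A Quot I)"
  "zero (quotient_algebra A I) = zero (A Quot I)"
  "add (quotient_algebra A I) = add (A Quot I)"
  "smult (quotient_algebra A I) a X = (\<Union>p\<in>X. I +>\<^bsub>A\<^esub> (a \<odot>\<^bsub>A\<^esub> p))"
  by (simp_all add: quotient_algebra_def ring.defs module.defs)

lemma ring_free_algebra: "ring (free_algebra :: ('k::comm_ring_1, ('g, 'k) free_alg) module)"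
proof (intro ringI abelian_groupI Group.monoidI)
  fix p :: "('g, 'k) free_alg"
  show "\<exists>q\<in>carrier free_algebra. q \<oplus>\<^bsub>free_algebra\<^esub> p = \<zero>\<^bsub>free_algebra\<^esub>"
    by (rule bexI[of _ "- p"]) simp_all
qed (simp_all add: algebra_simps)

lemma ideal_K2_ideal: "ideal K2_ideal free_algebra"
  unfolding K2_ideal_def by (rule ring.genideal_ideal[OF ring_free_algebra]) simp

lemma quotient_smult_coset:
  fixes p :: "('g, 'k::comm_ring_1) free_alg"
  assumes "ideal I free_algebra"
  shows "a \<odot>\<^bsub>quotient_algebra free_algebra I\<^esub> (I +>\<^bsub>free_algebra\<^esub> p)
       = I +>\<^bsub>free_algebra\<^esub> (scalar a * p)"
proof -
  interpret ideal I "free_algebra :: ('k, ('g, 'k) free_alg) module" by fact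
  have "I +>\<^bsub>free_algebra\<^esub> (scalar a * (i + p)) = I +>\<^bsub>free_algebra\<^esub> (scalar a * p)"
    if "i \<in> I" for i
  proof -
    have "scalar a * i \<in> I"
      using I_l_closed[OF that, of "scalar a"] by simp
    hence "scalar a * (i + p) \<in> I +>\<^bsub>free_algebra\<^esub> (scalar a * p)"
      by (auto simp: a_r_coset_def' distrib_left)
    thus ?thesis
      using a_repr_independence'[of "scalar a * (i + p)" "scalar a * p"] by simp
  qed
  moreover have "I \<noteq> {}"
    using additive_subgroup.zero_closed[OF additive_subgroup_axioms] by auto
  ultimately show ?thesis
    by (auto simp: quotient_algebra_simps a_r_coset_def'[of _ I p])
qed

lemma ring_C2: "ring C2"
proof -
  interpret Q: ring "free_algebra Quot K2_ideal"
    by (rule ideal.quotient_is_ring[OF ideal_K2_ideal])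
  show ?thesis
    unfolding C2_def
  proof (intro ringI abelian_groupI Group.monoidI, unfold quotient_algebra_simps)
    fix X assume "X \<in> carrier (free_algebra Quot K2_ideal)"
    thus "\<exists>Y\<in>carrier (free_algebra Quot K2_ideal).
            Y \<oplus>\<^bsub>free_algebra Quot K2_ideal\<^esub> X = \<zero>\<^bsub>free_algebra Quot K2_ideal\<^esub>"
      using Q.l_neg by blast
  qed (simp_all add: Q.a_ac Q.m_assoc Q.l_distr Q.r_distr)
qed

end

(* Put u = 1 + s x4, w = 1 + s x5 and v = 1 + x5 s.  The relation of x7 gives w u = 1.  In a
   matrix algebra one-sided inverses are two-sided, so u w = 1, whence x4 w = - x5 and
   (1 + x4 s) v = 1.  The relation v x18 = 0 of x22 then forces x18 = 0, so the relation
   u + c x18 = 0 of x19 gives u = 0, contradicting w u = 1. *)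

theory Submission
  imports Defs "Jordan_Normal_Form.Determinant"
begin

text \<open>Isolates the ring theory: \<open>x\<close>, \<open>y\<close>, \<open>z\<close> stand for
  the images of x4, x5, x18, and finite dimension enters only through \<open>two_sided\<close>. No
  signs are changed, so the argument is independent of the characteristic.\<close>

lemma (in ring) Dedekind_finite_relations_collapse:
  assumes two_sided: "\<And>a b. \<lbrakk>a \<in> carrier R; b \<in> carrier R; a \<otimes> b = \<one>\<rbrakk> \<Longrightarrow> b \<otimes> a = \<one>"
    and carr: "s \<in> carrier R" "x \<in> carrier R" "y \<in> carrier R" "z \<in> carrier R" "c \<in> carrier R"
    and r7: "x \<oplus> y \<otimes> (\<one> \<oplus> s \<otimes> x) = \<zero>"
    and r19: "(\<one> \<oplus> s \<otimes> x) \<oplus> c \<otimes> z = \<zero>"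
    and r22: "(\<one> \<oplus> y \<otimes> s) \<otimes> z = \<zero>"
  shows "\<one> = \<zero>"
proof -
  define u where "u = \<one> \<oplus> s \<otimes> x"
  define w where "w = \<one> \<oplus> s \<otimes> y"
  have carr_uw [simp]: "u \<in> carrier R" "w \<in> carrier R"
    using carr by (simp_all add: u_def w_def)
  have "w \<otimes> u = u \<oplus> s \<otimes> (y \<otimes> u)"
    using carr by (simp add: w_def l_distr m_assoc)
  also have "\<dots> = \<one> \<oplus> s \<otimes> (x \<oplus> y \<otimes> u)"
    using carr by (simp add: u_def[symmetric] r_distr) (simp add: u_def a_assoc)
  finally have wu: "w \<otimes> u = \<one>"
    using carr r7 by (simp add: u_def)
  have uw1: "u \<otimes> w = \<one>"
    by (rule two_sided[OF _ _ wu]) simp_all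
  \<comment> \<open>Multiplying \<open>r7\<close> by \<open>w\<close> on the right cancels
    \<open>u\<close>, which expresses \<open>y\<close> through \<open>x\<close> and
    \<open>w\<close>.\<close>
  have "x \<otimes> w \<oplus> y = (x \<oplus> y \<otimes> u) \<otimes> w"
    using carr by (simp add: l_distr m_assoc uw1)
  hence xw: "x \<otimes> w \<oplus> y = \<zero>"
    using r7 by (simp add: u_def[symmetric])
  \<comment> \<open>The usual passage from an inverse of 1 + ab to one of 1 + ba: the inverse 1 - y
    u s of 1 + y s equals 1 + x s, because \<open>r7\<close> says x = - y u.\<close>
  have "(\<one> \<oplus> x \<otimes> s) \<otimes> (\<one> \<oplus> y \<otimes> s) = \<one> \<oplus> (x \<otimes> w \<oplus> y) \<otimes> s"
    using carr by (simp add: w_def l_distr r_distr m_assoc a_ac)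
  hence "(\<one> \<oplus> x \<otimes> s) \<otimes> (\<one> \<oplus> y \<otimes> s) = \<one>"
    using carr xw by simp
  hence "(\<one> \<oplus> x \<otimes> s) \<otimes> ((\<one> \<oplus> y \<otimes> s) \<otimes> z) = z"
    using carr by (simp flip: m_assoc)
  hence "z = \<zero>"
    unfolding r22 using carr by simp
  hence "u = \<zero>"
    using carr r19 by (simp add: u_def)
  with wu show ?thesis
    by simp
qed

theorem mainTheorem3:
  shows "\<forall>n::nat. n \<ge> 1 \<longrightarrow> \<not> (\<exists>h. h \<in> algebra_hom C2 (matrix_algebra n))"
proof (intro allI impI notI, elim exE)
  fix n :: nat and h
  assume n: "n \<ge> 1" and "h \<in> algebra_hom C2 (matrix_algebra n)"
  hence h: "h \<in> Ring.ring_hom (free_algebra Quot K2_ideal) (matrix_algebra n)"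
    by (simp add: algebra_hom_def Ring.ring_hom_def C2_def quotient_algebra_simps)
  interpret I: ideal K2_ideal "free_algebra :: (bit, Ch_K2) module"
    by (rule ideal_K2_ideal)
  interpret M: ring "matrix_algebra n :: (bit, bit mat) module"
    by (intro ring.intro abelian_group_mat, unfold_locales)
      (auto simp: module_mat_simps add_mult_distrib_mat mult_add_distrib_mat)
  \<comment> \<open>Pulling \<open>h\<close> back along the projection replaces cosets by
    polynomials, so that each relation becomes a matrix equation.\<close>
  define g where "g = h \<circ> (+>\<^bsub>free_algebra :: (bit, Ch_K2) module\<^esub>) K2_ideal"
  have "g \<in> Ring.ring_hom free_algebra (matrix_algebra n)"
    unfolding g_def by (rule ring_hom_trans[OF I.rcos_ring_hom h])
  then interpret g: ring_hom_ring "free_algebra :: (bit, Ch_K2) module" "matrix_algebra n" g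
    by (intro ring_hom_ringI2 I.ring_axioms M.ring_axioms)
  have g_closed: "g p \<in> carrier (matrix_algebra n)" for p
    using g.hom_closed[of p] by simp
  have g_add: "g (p + q) = g p \<oplus>\<^bsub>matrix_algebra n\<^esub> g q" for p q
    using g.hom_add[of p q] by simp
  have g_mult: "g (p * q) = g p \<otimes>\<^bsub>matrix_algebra n\<^esub> g q" for p q
    using g.hom_mult[of p q] by simp
  have g_one: "g 1 = \<one>\<^bsub>matrix_algebra n\<^esub>"
    using g.hom_one by simp
  have relation: "g (K2_differential i) = \<zero>\<^bsub>matrix_algebra n\<^esub>" for i
  proof -
    have "K2_differential i \<in> K2_ideal"
      using I.genideal_self[of "range K2_differential"] by (auto simp: K2_ideal_def)
    hence "g (K2_differential i) = g 0"
      using I.a_rcos_const additive_subgroup.zero_closed[OF I.additive_subgroup_axioms] by (simp add: g_def)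
    thus ?thesis
      using g.hom_zero by simp
  qed
  have "\<one>\<^bsub>matrix_algebra n\<^esub> = (\<zero>\<^bsub>matrix_algebra n\<^esub> :: bit mat)"
  proof (rule M.Dedekind_finite_relations_collapse[of "g K2_s" "g (gen X4)" "g (gen X5)" "g (gen X18)" "g K2_c"])
    \<comment> \<open>Square matrices over the field \<open>bit\<close> are Dedekind finite.\<close>
    show "b \<otimes>\<^bsub>matrix_algebra n\<^esub> a = \<one>\<^bsub>matrix_algebra n\<^esub>"
      if "a \<in> carrier (matrix_algebra n)" "b \<in> carrier (matrix_algebra n)"
        "a \<otimes>\<^bsub>matrix_algebra n\<^esub> b = \<one>\<^bsub>matrix_algebra n\<^esub>" for a b :: "bit mat"
      using that mat_mult_left_right_inverse by (auto simp: module_mat_simps)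
  qed (use relation[of X7] relation[of X19] relation[of X22]
      in \<open>simp_all only: K2_differential.simps g_add g_mult g_one g_closed\<close>)
  \<comment> \<open>The entry (0, 0) exists because \<open>n\<close> is at least 1.\<close>
  hence "1\<^sub>m n $$ (0, 0) = (0\<^sub>m n n :: bit mat) $$ (0, 0)"
    by (simp only: module_mat_simps)
  with n show False
    by simp
qed

end
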